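(* Let $\mathcal{J}'(m,n)$ be the number of 012-partitions of $n$ of length $m$. Then, as formal power series in $z$ and $q$, $$\sum_{m,n\geq 0}\mathcal{J}'(m,n)\, z^m q^n = \frac{(-zq^2;q)_\infty\,(-z^2q^3;q)_\infty}{(z^3q^3;q)_\infty}.$$
   Context: A 012-partition of a non-negative integer $n$ of length $m$ is a sequence $(n_1,\dots,n_m)$ of non-negative integers with $\sum_i n_i = n$, last entry $n_m \geq 2$ (when $m\ge1$), and $n_j \geq n_{j+1}-1$, $n_j \geq n_{j+2}-2$, $n_j \geq n_{j+3}$ whenever the indices are in range. The empty sequence is the unique 012-partition of length $0$ (of $n=0$). Notation: $(a;q)_\infty = \prod_{i\ge0}(1-aq^i)$. *)

theory Defs
  imports "HOL-Analysis.Infinite_Products" "HOL-Computational_Algebra.Formal_Power_Series"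
begin

(* The entry n_{j+1} of the sequence is "ns ! j". The inequalities n_j >= n_{j+1} - 1 and
   n_j >= n_{j+2} - 2 are written additively, to keep clear of truncated subtraction. *)
definition partition_012 :: "nat \<Rightarrow> nat list \<Rightarrow> bool" where
  "partition_012 n ns \<longleftrightarrow>
     sum_list ns = n \<and>
     (ns \<noteq> [] \<longrightarrow> last ns \<ge> 2) \<and>
     (\<forall>j. j + 1 < length ns \<longrightarrow> ns ! j + 1 \<ge> ns ! (j + 1)) \<and>
     (\<forall>j. j + 2 < length ns \<longrightarrow> ns ! j + 2 \<ge> ns ! (j + 2)) \<and>
     (\<forall>j. j + 3 < length ns \<longrightarrow> ns ! j \<ge> ns ! (j + 3))"

definition num_partitions_012 :: "nat \<Rightarrow> nat \<Rightarrow> nat" where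
  "num_partitions_012 m n = card {ns. partition_012 n ns \<and> length ns = m}"

definition qpochhammer_inf :: "'a::{t2_space, comm_ring_1} \<Rightarrow> 'a \<Rightarrow> 'a" where
  "qpochhammer_inf a q = (\<Prod>i. 1 - a * q ^ i)"

(* Power series in z and q are taken as Q[[z]][[q]]: q is the outer variable, so that the topology
   in which the infinite products converge is the q-adic one. Rational rather than integer
   coefficients are used since division of power series needs an inverse on the coefficients. *)
type_synonym fps_zq = "rat fps fps"

abbreviation z_var :: fps_zq where "z_var \<equiv> fps_const fps_X"

abbreviation q_var :: fps_zq where "q_var \<equiv> fps_X"

definition fps_zq_of_coeffs :: "(nat \<Rightarrow> nat \<Rightarrow> rat) \<Rightarrow> fps_zq" where
  "fps_zq_of_coeffs c = Abs_fps (\<lambda>n. Abs_fps (\<lambda>m. c m n))"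

(* The denominator in the theorem is a genuine infinite product with constant coefficient 1, so
   neither the description operator in prodinf nor the division of power series is used on
   arguments where it is a mere convention. *)
lemma has_prod_qpochhammer_inf:
  fixes a :: fps_zq
  assumes a: "fps_nth a 0 = 0"
  shows "(\<lambda>i. 1 - a * q_var ^ i) has_prod qpochhammer_inf a q_var"
    and "fps_nth (qpochhammer_inf a q_var) 0 = 1"
proof -
  define f where "f = (\<lambda>i. 1 - a * q_var ^ i)"
  have f0: "fps_nth (f i) 0 = 1" for i
    using a by (simp add: f_def)
  have f_nz: "f i \<noteq> 0" for i
    using f0[of i] by auto
  have "\<exists>P. (\<lambda>n. \<Prod>k\<le>n. f k) \<longlonglongrightarrow> P"
  proof (cases "a = 0")
    case True
    hence "(\<lambda>n. \<Prod>k\<le>n. f k) = (\<lambda>n. 1)"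
      by (simp add: f_def)
    thus ?thesis
      by (metis tendsto_const)
  next
    case False
    have "subdegree (f k - 1) > n" if "k > n" for n k
      using False that by (simp add: f_def)
    thus ?thesis
      using tendsto_prod_fps[of f "\<lambda>n. n"] f_nz by blast
  qed
  then obtain P where P: "(\<lambda>n. \<Prod>k\<le>n. f k) \<longlonglongrightarrow> P"
    by blast
  have "fps_nth (\<Prod>k\<le>n. f k) 0 = 1" for n
    by (induction n) (simp_all add: f0)
  moreover from P have "eventually (\<lambda>n. fps_nth (\<Prod>k\<le>n. f k) 0 = fps_nth P 0) sequentially"
    by (simp add: tendsto_fps_iff)
  ultimately have P0: "fps_nth P 0 = 1"
    by auto
  hence "P \<noteq> 0"
    by auto
  with P have hp: "f has_prod P"
    by (simp add: has_prod_def raw_has_prod_def)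
  hence eq: "qpochhammer_inf a q_var = P"
    using has_prod_unique[OF hp] by (simp add: qpochhammer_inf_def f_def)
  show "(\<lambda>i. 1 - a * q_var ^ i) has_prod qpochhammer_inf a q_var"
    using hp eq by (simp add: f_def)
  show "fps_nth (qpochhammer_inf a q_var) 0 = 1"
    using P0 eq by simp
qed

lemma fps_zq_divide_mult_cancel:
  fixes f g :: fps_zq
  assumes g: "fps_nth g 0 = 1"
  shows "f / g * g = f"
proof -
  have "f / g = f * inverse g"
    using g by (intro fps_divide_unit) simp
  moreover have "inverse g * g = 1"
    using fps_left_inverse'[of 1 g 1] g by (simp add: fps_inverse_def[of g])
  ultimately show ?thesis
    by (simp add: mult.assoc)
qed

end

theory Submission
  imports Defs
begin

text \<open>
  Read from right to left, a 012-partition is built by appending entries \<open>x\<close> that respect lower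
  bounds \<open>(a, b, c)\<close> for the next three entries. Splitting on whether the next entry equals \<open>a\<close>
  expresses the generating function of each state \<open>(a, b, c)\<close> through two others. Up to adding a
  constant \<open>k\<close> to all bounds, i.e. substituting \<open>z q\<^sup>k\<close> for \<open>z\<close>, only finitely many states are
  reachable from \<open>(2, 1, 0)\<close>, and solving the resulting linear system for that state \<open>A\<close> gives, with
  \<open>w = z q\<^sup>k\<close>,
  \<open>(1 - w\<^sup>3 q\<^sup>3) (1 - w\<^sup>3 q\<^sup>4) (1 - w\<^sup>3 q\<^sup>5) A\<^sub>k = (1 + w q\<^sup>2) (1 + w\<^sup>2 q\<^sup>3) (1 + w\<^sup>2 q\<^sup>4) A\<^sub>k\<^sub>+\<^sub>1\<close>.
  Iterating and letting \<open>k\<close> tend to infinity yields the product, since \<open>A\<^sub>k\<close> tends to \<open>1\<close>.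
\<close>

section \<open>012-partitions read from right to left\<close>

fun above :: "nat \<Rightarrow> nat \<Rightarrow> nat \<Rightarrow> nat list \<Rightarrow> bool" where
  "above a b c [] \<longleftrightarrow> True"
| "above a b c (x # xs) \<longleftrightarrow> a \<le> x \<and> above (max b (x - 1)) (max c (x - 2)) x xs"

lemma all_nat_split: "(\<forall>j::nat. P j) \<longleftrightarrow> P 0 \<and> (\<forall>j. P (Suc j))"
  by (metis not0_implies_Suc)

lemma above_iff:
  "above a b c xs \<longleftrightarrow>
     (0 < length xs \<longrightarrow> a \<le> xs ! 0) \<and> (1 < length xs \<longrightarrow> b \<le> xs ! 1) \<and>
     (2 < length xs \<longrightarrow> c \<le> xs ! 2) \<and>
     (\<forall>j. j + 1 < length xs \<longrightarrow> xs ! j \<le> xs ! (j + 1) + 1) \<and>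
     (\<forall>j. j + 2 < length xs \<longrightarrow> xs ! j \<le> xs ! (j + 2) + 2) \<and>
     (\<forall>j. j + 3 < length xs \<longrightarrow> xs ! j \<le> xs ! (j + 3))"
proof (induction xs arbitrary: a b c)
  case Nil
  show ?case by simp
next
  case (Cons x xs)
  show ?case
    unfolding above.simps Cons.IH
    \<comment> \<open>Splitting off j = 0 for \<open>x # xs\<close> isolates the bounds that
      \<open>x\<close> sets for its three successors; the other indices concern \<open>xs\<close>
      alone.\<close>
    by (subst (4 5 6) all_nat_split) (auto simp: numeral_2_eq_2 numeral_3_eq_3)
qed

lemma all_rev_nthI:
  assumes "\<And>j. j + k < length xs \<Longrightarrow> P (xs ! (j + k)) (xs ! j)"
    and "j + k < length xs"
  shows "P (rev xs ! j) (rev xs ! (j + k))"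
proof -
  \<comment> \<open>Mirror image of position j + k; reversal exchanges the two positions, hence the
    swapped arguments of \<open>P\<close>.\<close>
  define i where "i = length xs - Suc (j + k)"
  have "rev xs ! j = xs ! (i + k)" "rev xs ! (j + k) = xs ! i" "i + k < length xs"
    using assms(2) by (auto simp: rev_nth i_def intro!: arg_cong[of _ _ "nth xs"])
  with assms(1) show ?thesis by simp
qed

lemma all_rev_nth:
  "(\<forall>j. j + k < length xs \<longrightarrow> P (rev xs ! j) (rev xs ! (j + k))) \<longleftrightarrow>
   (\<forall>j. j + k < length xs \<longrightarrow> P (xs ! (j + k)) (xs ! j))"
  using all_rev_nthI[of k xs P] all_rev_nthI[of k "rev xs" "\<lambda>x y. P y x"] by auto

text \<open>A first entry of at least a forces the next two to be at least a - 1 and a - 2. Raising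
  the bounds accordingly keeps the reachable states finite up to shift.\<close>

lemma above_normalize: "above a b c xs = above a (max b (a - 1)) (max c (a - 2)) xs"
proof (cases xs)
  case (Cons x ys)
  have "max (max b (a - 1)) (x - 1) = max b (x - 1)" "max (max c (a - 2)) (x - 2) = max c (x - 2)"
    if "a \<le> x"
    using that by (simp_all add: max.assoc max_absorb2 diff_le_mono)
  with Cons show ?thesis by auto
qed simp

lemma partition_012_iff_above:
  "partition_012 n ns \<longleftrightarrow> sum_list ns = n \<and> above 2 1 0 (rev ns)"
proof -
  \<comment> \<open>The definition only bounds the last part, by 2; (2, 1, 0) is the normalized form
    of that condition.\<close>
  have "above 2 1 0 (rev ns) = above 2 0 0 (rev ns)"
    using above_normalize[of 2 0 0 "rev ns"] by simp
  moreover have "rev ns ! 0 = last ns" if "ns \<noteq> []"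
    using that by (simp add: rev_nth last_conv_nth)
  ultimately show ?thesis
    unfolding partition_012_def above_iff
    using all_rev_nth[of 1 ns "\<lambda>x y. x \<le> y + 1"] all_rev_nth[of 2 ns "\<lambda>x y. x \<le> y + 2"]
      all_rev_nth[of 3 ns "(\<le>)"]
    by auto
qed

section \<open>Generating functions of the states and their linear system\<close>

definition above_lists :: "nat \<Rightarrow> nat \<Rightarrow> nat \<Rightarrow> nat \<Rightarrow> nat \<Rightarrow> nat list set" where
  "above_lists a b c m n = {xs. above a b c xs \<and> length xs = m \<and> sum_list xs = n}"

definition above_gf :: "nat \<Rightarrow> nat \<Rightarrow> nat \<Rightarrow> fps_zq" where
  "above_gf a b c = fps_zq_of_coeffs (\<lambda>m n. of_nat (card (above_lists a b c m n)))"

lemma finite_above_lists [simp]: "finite (above_lists a b c m n)"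
proof (rule finite_subset)
  show "above_lists a b c m n \<subseteq> {xs. set xs \<subseteq> {..n} \<and> length xs = m}"
    by (auto simp: above_lists_def dest: member_le_sum_list)
  show "finite {xs. set xs \<subseteq> {..n} \<and> length xs = m}"
    by (rule finite_lists_length_eq) simp
qed

lemma card_above_lists_rec:
  "card (above_lists a b c m n) = card (above_lists (Suc a) b c m n) +
     (if m = 0 \<or> n < a then 0
      else card (above_lists (max b (a - 1)) (max c (a - 2)) a (m - 1) (n - a)))"
proof -
  \<comment> \<open>The lists starting with exactly a; all others, including the empty list, satisfy
    the bound a + 1.\<close>
  define T where "T = (if m = 0 \<or> n < a then {}
      else (#) a ` above_lists (max b (a - 1)) (max c (a - 2)) a (m - 1) (n - a))"
  have "above_lists a b c m n = above_lists (Suc a) b c m n \<union> T"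
  proof (intro set_eqI)
    fix xs
    show "xs \<in> above_lists a b c m n \<longleftrightarrow> xs \<in> above_lists (Suc a) b c m n \<union> T"
      by (cases xs; cases "hd xs = a") (auto simp: above_lists_def T_def)
  qed
  moreover have "\<exists>ys. xs = a # ys" if "xs \<in> T" for xs
    using that unfolding T_def image_def by (simp split: if_splits) blast
  then have "xs \<notin> above_lists (Suc a) b c m n" if "xs \<in> T" for xs
    using that by (force simp: above_lists_def)
  then have "above_lists (Suc a) b c m n \<inter> T = {}" by blast
  moreover have "finite T" by (simp add: T_def)
  ultimately show ?thesis
    by (simp add: card_Un_disjoint T_def card_image)
qed

lemma card_above_lists_210: "card (above_lists 2 1 0 m n) = num_partitions_012 m n"
proof -
  have "above_lists 2 1 0 m n = rev ` {ns. partition_012 n ns \<and> length ns = m}"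
  proof (intro set_eqI iffI)
    fix xs assume "xs \<in> above_lists 2 1 0 m n"
    then have "partition_012 n (rev xs)" "length (rev xs) = m"
      by (simp_all add: above_lists_def partition_012_iff_above)
    then show "xs \<in> rev ` {ns. partition_012 n ns \<and> length ns = m}"
      by (intro image_eqI[of _ _ "rev xs"]) simp_all
  qed (auto simp: above_lists_def partition_012_iff_above)
  then show ?thesis
    by (simp add: num_partitions_012_def card_image)
qed

text \<open>Prepending a multiplies by z q^a; the remaining state is replaced by its normalized
  form. Bounds enter as equations so that \<open>simp\<close> can evaluate the maxima for concrete
  states.\<close>

lemma above_gf_rec:
  assumes "b' = max b (a - 1)" "c' = max c (a - 2)"
    and "b'' = max b a" "c'' = max c (a - 1)" "a'' = Suc a"
  shows "above_gf a b c = z_var * q_var ^ a * above_gf b' c' a + above_gf a'' b'' c''"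
proof -
  have "above_lists (Suc a) b c m n = above_lists a'' b'' c'' m n" for m n
    using above_normalize[of "Suc a" b c] assms(3-) by (simp add: above_lists_def)
  then have "card (above_lists a b c m n) = card (above_lists a'' b'' c'' m n) +
      (if m = 0 \<or> n < a then 0 else card (above_lists b' c' a (m - 1) (n - a)))" for m n
    using card_above_lists_rec[of a b c m n] assms(1,2) by simp
  then show ?thesis
    by (auto simp: fps_eq_iff above_gf_def fps_zq_of_coeffs_def mult.assoc fps_X_power_mult_nth)
qed

lemma above_gf_shift_rec:
  assumes "b' = max b (k + i - 1)" "c' = max c (k + i - 2)"
    and "b'' = max b (k + i)" "c'' = max c (k + i - 1)" "a'' = Suc (k + i)"
  shows "above_gf (k + i) b c =
    (z_var * q_var ^ k) * q_var ^ i * above_gf b' c' (k + i) + above_gf a'' b'' c''"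
  using above_gf_rec[OF assms] by (simp add: power_add mult.assoc)

text \<open>A nonempty list has sum at least a > n, so only the empty list counts: the series is 1
  modulo q^a.\<close>

lemma above_gf_nth_small:
  assumes "n < a"
  shows "fps_nth (above_gf a b c) n = (if n = 0 then 1 else 0)"
proof -
  have "above_lists a b c m n = (if m = 0 \<and> n = 0 then {[]} else {})" for m
  proof (intro set_eqI)
    fix xs
    show "xs \<in> above_lists a b c m n \<longleftrightarrow> xs \<in> (if m = 0 \<and> n = 0 then {[]} else {})"
      using assms by (cases xs) (auto simp: above_lists_def)
  qed
  then show ?thesis
    by (auto simp: fps_eq_iff above_gf_def fps_zq_of_coeffs_def)
qed

text \<open>Letters name the states as in \<open>above_gf_210_step\<close>; \<open>A1\<close>,
  \<open>A2\<close> are \<open>A\<close> shifted by one and two, \<open>I1\<close> is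
  \<open>I\<close> shifted by one. The last relation makes the recurrence first order: it turns
  \<open>F\<close> into a multiple of \<open>A1\<close>, removing \<open>A2\<close> and
  \<open>I1\<close> together.\<close>

lemma linear_system_solution:
  fixes w q :: "'a::idom"
  assumes A: "A = w * q^2 * B + A1" and B: "B = w * q * C + D" and C: "C = w * A + G"
    and D: "D = w * q^2 * E + F" and F: "F = w * q^3 * I1 + A2" and G: "G = w * q * H + J"
    and H: "H = w * q^2 * I + A1" and I: "I = w * q * G + D" and J: "J = w * q^2 * D + A1"
    and E: "E = w * q * J + K" and K: "K = w * q^2 * K + F"
    and I1: "(1 - w^3 * q^6) * A1 = w * q^3 * I1 + A2"
    and nz: "1 - w * q^2 \<noteq> 0"
  shows "(1 - w^3 * q^3) * (1 - w^3 * q^4) * (1 - w^3 * q^5) * A =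
      (1 + w * q^2) * (1 + w^2 * q^3) * (1 + w^2 * q^4) * A1"
proof -
  have F': "F = (1 - w^3 * q^6) * A1" using F I1 by simp
  \<comment> \<open>1 - w^3 q^6 = (1 - w q^2) (1 + w q^2 + w^2 q^4).\<close>
  have "(1 - w * q^2) * K = (1 - w * q^2) * ((1 + w * q^2 + w^2 * q^4) * A1)"
    using K F' by algebra
  with nz have "K = (1 + w * q^2 + w^2 * q^4) * A1" by simp
  \<comment> \<open>Substituting \<open>E\<close> into \<open>D\<close> leaves w q^2 K + F, which is
    \<open>K\<close> again.\<close>
  with D E F' have "D = w^2 * q^3 * J + (1 + w * q^2 + w^2 * q^4) * A1" by algebra
  with J have 1: "(1 - w^3 * q^5) * J = (1 + w * q^2) * (1 + w^2 * q^4) * A1" by algebra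
  \<comment> \<open>By \<open>J\<close>, the combination w q^2 D + A1 is \<open>J\<close>, both here
    and in the equation for \<open>A\<close> below.\<close>
  have 2: "(1 - w^3 * q^4) * G = (1 + w * q) * J" using G H I J by algebra
  have "(1 - w^3 * q^3) * A = J + w^2 * q^3 * G" using A B C J by algebra
  with 2 have "(1 - w^3 * q^3) * (1 - w^3 * q^4) * A = (1 + w^2 * q^3) * J" by algebra
  with 1 show ?thesis by algebra
qed

text \<open>The equations for (1, 0, 2) and (1, 1, 2) differ only by w^2 q times (2, 1, 0). Used one
  shift higher, this eliminates the doubly shifted state.\<close>

lemma above_gf_210_112:
  fixes k
  defines "w \<equiv> z_var * q_var ^ k"
  shows "(1 - w^3 * q_var^3) * above_gf (k + 2) (k + 1) k =
    w * q_var^2 * above_gf (k + 1) (k + 1) (k + 2) + above_gf (k + 3) (k + 2) (k + 1)"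
proof -
  let ?g = "\<lambda>a b c. above_gf (k + a) (k + b) (k + c)"
  have "?g 2 1 0 = w * q_var^2 * ?g 1 0 2 + ?g 3 2 1"
    "?g 1 0 2 = w * q_var^1 * ?g 0 2 1 + ?g 2 1 2"
    "?g 0 2 1 = w * q_var^0 * ?g 2 1 0 + ?g 1 2 1"
    "?g 1 1 2 = w * q_var^1 * ?g 1 2 1 + ?g 2 1 2"
    unfolding w_def by (rule above_gf_shift_rec; simp)+
  then show ?thesis
    by simp algebra
qed

lemma above_gf_210_step:
  fixes k
  defines "w \<equiv> z_var * q_var ^ k"
  shows "(1 - w^3 * q_var^3) * (1 - w^3 * q_var^4) * (1 - w^3 * q_var^5) * above_gf (k + 2) (k + 1) k =
    (1 + w * q_var^2) * (1 + w^2 * q_var^3) * (1 + w^2 * q_var^4) * above_gf (k + 3) (k + 2) (k + 1)"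
proof -
  let ?g = "\<lambda>a b c. above_gf (k + a) (k + b) (k + c)"
  have
    A: "?g 2 1 0 = w * q_var^2 * ?g 1 0 2 + ?g 3 2 1" and
    B: "?g 1 0 2 = w * q_var^1 * ?g 0 2 1 + ?g 2 1 2" and
    C: "?g 0 2 1 = w * q_var^0 * ?g 2 1 0 + ?g 1 2 1" and
    D: "?g 2 1 2 = w * q_var^2 * ?g 1 2 2 + ?g 3 2 2" and
    F: "?g 3 2 2 = w * q_var^3 * ?g 2 2 3 + ?g 4 3 2" and
    G: "?g 1 2 1 = w * q_var^1 * ?g 2 1 1 + ?g 2 2 1" and
    H: "?g 2 1 1 = w * q_var^2 * ?g 1 1 2 + ?g 3 2 1" and
    I: "?g 1 1 2 = w * q_var^1 * ?g 1 2 1 + ?g 2 1 2" and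
    J: "?g 2 2 1 = w * q_var^2 * ?g 2 1 2 + ?g 3 2 1" and
    E: "?g 1 2 2 = w * q_var^1 * ?g 2 2 1 + ?g 2 2 2" and
    K: "?g 2 2 2 = w * q_var^2 * ?g 2 2 2 + ?g 3 2 2"
    unfolding w_def by (rule above_gf_shift_rec; simp)+
  \<comment> \<open>Passing to k + 1 replaces w by w q and the state (1, 1, 2) by (2, 2, 3).\<close>
  have "(1 - w^3 * q_var^6) * ?g 3 2 1 = w * q_var^3 * ?g 2 2 3 + ?g 4 3 2"
    using above_gf_210_112[of "k + 1"]
    by (simp add: w_def power_mult_distrib mult.assoc numeral_eq_Suc mult_ac)
  moreover have "fps_nth (1 - w * q_var ^ 2) 0 = 1"
    by (simp add: w_def)
  then have "1 - w * q_var ^ 2 \<noteq> 0" by (metis fps_zero_nth zero_neq_one)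
  ultimately show ?thesis
    using linear_system_solution[OF A B[unfolded power_one_right] _ D F G[unfolded power_one_right] H
       I[unfolded power_one_right] J E[unfolded power_one_right] K] C by simp
qed

section \<open>Iteration and passage to the infinite products\<close>

lemma fps_mult_nth_cong:
  assumes "\<forall>j\<le>n. fps_nth f j = fps_nth f' j" "\<forall>j\<le>n. fps_nth g j = fps_nth g' j"
  shows "\<forall>j\<le>n. fps_nth (f * g) j = fps_nth (f' * g') j"
proof (intro allI impI)
  fix j assume "j \<le> n"
  with assms show "fps_nth (f * g) j = fps_nth (f' * g') j"
    unfolding fps_mult_nth by (intro sum.cong refl arg_cong2[of _ _ _ _ "(*)"]) simp_all
qed

text \<open>Convergence means that each coefficient is eventually constant, and finitely many
  coefficients share a threshold.\<close>

lemma has_prod_eventually_nth: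
  fixes P :: "'a::idom fps"
  assumes "f has_prod P"
  shows "eventually (\<lambda>N. \<forall>j\<le>n. fps_nth (\<Prod>i<N. f i) j = fps_nth P j) sequentially"
proof -
  have "eventually (\<lambda>N. fps_nth (\<Prod>i<N. f i) j = fps_nth P j) sequentially" for j
    using has_prod_imp_tendsto'[OF assms] unfolding tendsto_fps_iff by blast
  then have "eventually (\<lambda>N. \<forall>j\<in>{..n}. fps_nth (\<Prod>i<N. f i) j = fps_nth P j) sequentially"
    by (intro eventually_ball_finite finite_atMost ballI)
  then show ?thesis unfolding Ball_def atMost_iff .
qed

text \<open>One step of the recurrence uses one, two and three factors of the respective products,
  since w, w^2, w^3 carry q^N, q^(2N), q^(3N).\<close>

lemma qpochhammer_factors:
  fixes z q :: "'a::comm_ring_1"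
  defines "w \<equiv> \<lambda>N. z * q ^ N"
  shows "(\<Prod>i<Suc N. 1 - (- (z * q^2)) * q ^ i) =
      (\<Prod>i<N. 1 - (- (z * q^2)) * q ^ i) * (1 + w N * q^2)"
    and "(\<Prod>i<2 * Suc N. 1 - (- (z^2 * q^3)) * q ^ i) =
      (\<Prod>i<2 * N. 1 - (- (z^2 * q^3)) * q ^ i) * ((1 + w N ^ 2 * q^3) * (1 + w N ^ 2 * q^4))"
    and "(\<Prod>i<3 * Suc N. 1 - z^3 * q^3 * q ^ i) =
      (\<Prod>i<3 * N. 1 - z^3 * q^3 * q ^ i) *
        ((1 - w N ^ 3 * q^3) * (1 - w N ^ 3 * q^4) * (1 - w N ^ 3 * q^5))"
proof -
  have 2: "2 * Suc N = Suc (Suc (2 * N))" and 3: "3 * Suc N = Suc (Suc (Suc (3 * N)))"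
    by simp_all
  have pow: "q ^ (2 * N) = (q ^ N)^2" "q ^ (3 * N) = (q ^ N)^3"
    by (simp_all add: power_mult mult.commute flip: power_mult)
  show "(\<Prod>i<Suc N. 1 - (- (z * q^2)) * q ^ i) =
      (\<Prod>i<N. 1 - (- (z * q^2)) * q ^ i) * (1 + w N * q^2)"
    by (simp add: w_def mult_ac)
  have "1 - (- (z^2 * q^3)) * q ^ (2 * N) = 1 + w N ^ 2 * q^3"
    "1 - (- (z^2 * q^3)) * q ^ Suc (2 * N) = 1 + w N ^ 2 * q^4"
    unfolding w_def power_Suc pow
    by (simp_all add: power_mult_distrib eval_nat_numeral mult_ac)
  then show "(\<Prod>i<2 * Suc N. 1 - (- (z^2 * q^3)) * q ^ i) =
      (\<Prod>i<2 * N. 1 - (- (z^2 * q^3)) * q ^ i) * ((1 + w N ^ 2 * q^3) * (1 + w N ^ 2 * q^4))"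
    by (simp only: 2 prod.lessThan_Suc mult.assoc)
  have "1 - z^3 * q^3 * q ^ (3 * N) = 1 - w N ^ 3 * q^3"
    "1 - z^3 * q^3 * q ^ Suc (3 * N) = 1 - w N ^ 3 * q^4"
    "1 - z^3 * q^3 * q ^ Suc (Suc (3 * N)) = 1 - w N ^ 3 * q^5"
    unfolding w_def power_Suc pow
    by (simp_all add: power_mult_distrib eval_nat_numeral mult_ac)
  then show "(\<Prod>i<3 * Suc N. 1 - z^3 * q^3 * q ^ i) =
      (\<Prod>i<3 * N. 1 - z^3 * q^3 * q ^ i) *
        ((1 - w N ^ 3 * q^3) * (1 - w N ^ 3 * q^4) * (1 - w N ^ 3 * q^5))"
    by (simp only: 3 prod.lessThan_Suc mult.assoc)
qed

lemma above_gf_210_iterate: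
  "(\<Prod>i<3 * N. 1 - z_var ^ 3 * q_var ^ 3 * q_var ^ i) * above_gf 2 1 0 =
   (\<Prod>i<N. 1 - (- (z_var * q_var ^ 2)) * q_var ^ i) *
   (\<Prod>i<2 * N. 1 - (- (z_var ^ 2 * q_var ^ 3)) * q_var ^ i) * above_gf (N + 2) (N + 1) N"
proof (induction N)
  case 0
  show ?case by (simp add: numeral_2_eq_2)
next
  case (Suc N)
  \<comment> \<open>Stated for arbitrary series so that \<open>algebra\<close> meets only atoms;
    \<open>d\<close> and \<open>n1\<close>, \<open>n2\<close>, \<open>n3\<close> stand for the new
    factors, and \<open>K\<close> is the state to be eliminated.\<close>
  have regroup: "P3 * d * L = P1 * n1 * (P2 * (n2 * n3)) * L'"
    if "P3 * L = P1 * P2 * K" "d * K = n1 * n2 * n3 * L'"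
    for P1 P2 P3 d L L' K n1 n2 n3 :: fps_zq
    using that by algebra
  have "above_gf (N + 3) (N + 2) (N + 1) = above_gf (Suc N + 2) (Suc N + 1) (Suc N)"
    by (simp add: eval_nat_numeral)
  with regroup[OF Suc.IH above_gf_210_step] show ?case
    unfolding qpochhammer_factors by simp
qed

theorem theorem24:
  shows "fps_zq_of_coeffs (\<lambda>m n. of_nat (num_partitions_012 m n)) =
    qpochhammer_inf (- (z_var * q_var ^ 2)) q_var * qpochhammer_inf (- (z_var ^ 2 * q_var ^ 3)) q_var
      / qpochhammer_inf (z_var ^ 3 * q_var ^ 3) q_var"
  (is "?L = ?P1 * ?P2 / ?P3")
proof -
  have L: "?L = above_gf 2 1 0"
    unfolding above_gf_def card_above_lists_210 ..
  note P1 = has_prod_qpochhammer_inf(1)[of "- (z_var * q_var ^ 2)"]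
  note P2 = has_prod_qpochhammer_inf(1)[of "- (z_var ^ 2 * q_var ^ 3)"]
  note P3 = has_prod_qpochhammer_inf(1)[of "z_var ^ 3 * q_var ^ 3"]
  \<comment> \<open>With the denominator cleared, each coefficient can be compared through finite
    products.\<close>
  have "fps_nth (?P3 * ?L) n = fps_nth (?P1 * ?P2) n" for n
  proof -
    let ?Q1 = "\<lambda>N. \<Prod>i<N. 1 - (- (z_var * q_var ^ 2)) * q_var ^ i"
    let ?Q2 = "\<lambda>N. \<Prod>i<N. 1 - (- (z_var ^ 2 * q_var ^ 3)) * q_var ^ i"
    let ?Q3 = "\<lambda>N. \<Prod>i<N. 1 - z_var ^ 3 * q_var ^ 3 * q_var ^ i"
    have "\<exists>M. \<forall>N\<ge>M. \<forall>j\<le>n. fps_nth (?Q1 N) j = fps_nth ?P1 j"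
      using has_prod_eventually_nth[OF P1, of n] by (simp add: eventually_sequentially)
    then obtain M1 where M1: "\<And>N. N \<ge> M1 \<Longrightarrow> \<forall>j\<le>n. fps_nth (?Q1 N) j = fps_nth ?P1 j"
      by blast
    have "\<exists>M. \<forall>N\<ge>M. \<forall>j\<le>n. fps_nth (?Q2 N) j = fps_nth ?P2 j"
      using has_prod_eventually_nth[OF P2, of n] by (simp add: eventually_sequentially)
    then obtain M2 where M2: "\<And>N. N \<ge> M2 \<Longrightarrow> \<forall>j\<le>n. fps_nth (?Q2 N) j = fps_nth ?P2 j"
      by blast
    have "\<exists>M. \<forall>N\<ge>M. \<forall>j\<le>n. fps_nth (?Q3 N) j = fps_nth ?P3 j"
      using has_prod_eventually_nth[OF P3, of n] by (simp add: eventually_sequentially)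
    then obtain M3 where M3: "\<And>N. N \<ge> M3 \<Longrightarrow> \<forall>j\<le>n. fps_nth (?Q3 N) j = fps_nth ?P3 j"
      by blast
    \<comment> \<open>\<open>N\<close>, 2 N and 3 N reach all thresholds; the summand n makes the
      remaining state agree with 1 up to q^n.\<close>
    define N where "N = n + M1 + M2 + M3"
    have tail: "\<forall>j\<le>n. fps_nth (above_gf (N + 2) (N + 1) N) j = fps_nth 1 j"
      by (auto simp: above_gf_nth_small N_def)
    have "fps_nth (?P3 * ?L) n = fps_nth (?Q3 (3 * N) * above_gf 2 1 0) n"
      using fps_mult_nth_cong[OF M3[of "3 * N"], of ?L ?L] L by (simp add: N_def)
    also have "\<dots> = fps_nth (?Q1 N * ?Q2 (2 * N) * above_gf (N + 2) (N + 1) N) n"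
      by (simp only: above_gf_210_iterate)
    also have "\<dots> = fps_nth (?P1 * ?P2 * 1) n"
      using fps_mult_nth_cong[OF fps_mult_nth_cong[OF M1[of N] M2[of "2 * N"]] tail]
      by (simp add: N_def)
    finally show ?thesis by simp
  qed
  then have "?P3 * ?L = ?P1 * ?P2"
    by (simp add: fps_eq_iff)
  moreover have "?P1 * ?P2 / ?P3 * ?P3 = ?P1 * ?P2"
    by (intro fps_zq_divide_mult_cancel has_prod_qpochhammer_inf(2)) simp
  moreover have "?P3 \<noteq> 0"
    using has_prod_qpochhammer_inf(2)[of "z_var ^ 3 * q_var ^ 3"] by auto
  ultimately show ?thesis
    by (metis mult.commute mult_cancel_left)
qed

end
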